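(* Let $p$ be an explanation predicate and let a user question $(\alpha_i,\alpha_j,>)$ with respect to a group-by query with aggregation $agg$ be given. Let $\mathrm{Inf}(p)=\mathrm{Inf}(p;D)$ be the influence defined in the context, and let its sensitivity be $\sup_{D\approx D'}|\mathrm{Inf}(p;D)-\mathrm{Inf}(p;D')|$. Then the following holds: (1) if $agg=COUNT$, the sensitivity of $\mathrm{Inf}(p)$ is $4$; (2) if $agg=SUM$, the sensitivity of $\mathrm{Inf}(p)$ is $4A_{agg}^{max}$; (3) if $agg=AVG$, the sensitivity of $\mathrm{Inf}(p)$ is $16A_{agg}^{max}$.
   Context: A database $D$ is a bag of tuples over attributes with given domains. $D\approx D'$ (neighboring) if $D'$ is obtained from $D$ by adding or removing one tuple. The query is SELECT $A_{gb}$, $agg(A_{agg})$ FROM $D$ WHERE $\phi$ GROUP BY $A_{gb}$, with $agg\in\{COUNT,SUM,AVG\}$ and $\phi$ a Boolean predicate on tuples; $A_{agg}^{max}=\max\{|a|:a\in\mathrm{dom}(A_{agg})\}$. The user question $(\alpha_i,\alpha_j,>)$ asks why the (noisy) aggregate value of group $\alpha_i$ is larger than that of group $\alpha_j$, where $\alpha_i,\alpha_j\in\mathrm{dom}(A_{gb})$ are two groups. For any bag $D$, $g_i(D)$ is the bag of tuples of $D$ satisfying $\phi\wedge(A_{gb}=\alpha_i)$, similarly $g_j(D)$. For a bag $E$ of tuples, $agg(E)$ is the aggregate (number of tuples, sum, or average) of the $A_{agg}$-values of the tuples in $E$. An explanation predicate $p$ is a Boolean predicate on tuples which is a conjunction of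 conditions $A=a$ with $A$ an attribute other than $A_{gb},A_{agg}$ and $a\in\mathrm{dom}(A)$. $\neg p(D)$ is the bag of tuples of $D$ not satisfying $p$. The influence is $$\mathrm{Inf}(p;D)=\Big(\big(agg(g_i(D))-agg(g_j(D))\big)-\big(agg(g_i(\neg p(D)))-agg(g_j(\neg p(D)))\big)\Big)\times W,$$ where $W=\dfrac{\min(|g_i(\neg p(D))|,|g_j(\neg p(D))|)}{\max(|g_i(D)|,|g_j(D)|)+1}$ if $agg\in\{COUNT,SUM\}$ and $W=\min(|g_i(\neg p(D))|,|g_j(\neg p(D))|)$ if $agg=AVG$. When $W=0$ the influence is $0$ (also if an average over an empty bag occurs in the first factor).
   Formalization: The sensitivity is shown to be at most 4, 4A_max and 16A_max, not equal to these values; equality is false, e.g. if the WHERE condition is unsatisfiable the influence is identically 0, and the values are never attained unless A_max = 0. *)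

theory Defs
  imports "HOL-Library.Multiset" "HOL-Library.FuncSet" "HOL-Library.Extended_Nonnegative_Real"
begin

type_synonym ('a, 'v) tup = "'a \<Rightarrow> 'v"

text \<open>All attribute values share the type \<open>'v\<close>; \<open>num\<close> gives the numerical value that the
  aggregates Sum and Avg attach to a value of the aggregated attribute.\<close>

record ('a, 'v) schema =
  attrs :: "'a set"
  attr_dom :: "'a \<Rightarrow> 'v set"
  num :: "'v \<Rightarrow> real"

definition tuples :: "('a, 'v) schema \<Rightarrow> ('a, 'v) tup set" where
  "tuples S = (\<Pi>\<^sub>E A\<in>attrs S. attr_dom S A)"

definition database :: "('a, 'v) schema \<Rightarrow> ('a, 'v) tup multiset \<Rightarrow> bool" where
  "database S D \<longleftrightarrow> set_mset D \<subseteq> tuples S"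

definition neighboring ::
    "('a, 'v) schema \<Rightarrow> ('a, 'v) tup multiset \<Rightarrow> ('a, 'v) tup multiset \<Rightarrow> bool" where
  "neighboring S D D' \<longleftrightarrow> database S D \<and> database S D' \<and>
     (\<exists>t. D' = add_mset t D \<or> D = add_mset t D')"

datatype aggregate = Count | Sum | Avg

record ('a, 'v) gb_query =
  gb_attr :: 'a
  agg_attr :: 'a
  agg_fun :: aggregate
  where_cond :: "('a, 'v) tup \<Rightarrow> bool"

definition query_over :: "('a, 'v) schema \<Rightarrow> ('a, 'v) gb_query \<Rightarrow> bool" where
  "query_over S Q \<longleftrightarrow> gb_attr Q \<in> attrs S \<and> agg_attr Q \<in> attrs S"

definition is_agg_max :: "('a, 'v) schema \<Rightarrow> ('a, 'v) gb_query \<Rightarrow> real \<Rightarrow> bool" where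
  "is_agg_max S Q m \<longleftrightarrow>
     m \<in> (\<lambda>a. \<bar>num S a\<bar>) ` attr_dom S (agg_attr Q) \<and>
     (\<forall>a\<in>attr_dom S (agg_attr Q). \<bar>num S a\<bar> \<le> m)"

definition explanation_predicate ::
    "('a, 'v) schema \<Rightarrow> ('a, 'v) gb_query \<Rightarrow> (('a, 'v) tup \<Rightarrow> bool) \<Rightarrow> bool" where
  "explanation_predicate S Q p \<longleftrightarrow>
     (\<exists>C. finite C \<and>
          C \<subseteq> (SIGMA A : attrs S - {gb_attr Q, agg_attr Q}. attr_dom S A) \<and>
          p = (\<lambda>t. \<forall>(A, a)\<in>C. t A = a))"

definition group ::
    "('a, 'v) gb_query \<Rightarrow> 'v \<Rightarrow> ('a, 'v) tup multiset \<Rightarrow> ('a, 'v) tup multiset" where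
  "group Q \<alpha> D = {#t \<in># D. where_cond Q t \<and> t (gb_attr Q) = \<alpha>#}"

definition neg_sel ::
    "(('a, 'v) tup \<Rightarrow> bool) \<Rightarrow> ('a, 'v) tup multiset \<Rightarrow> ('a, 'v) tup multiset" where
  "neg_sel p D = {#t \<in># D. \<not> p t#}"

text \<open>The average over an empty bag is \<open>0 / 0 = 0\<close>. This value never matters: such a bag
  forces the factor \<open>weight\<close> below to be \<open>0\<close>, and with it the influence.\<close>

definition agg ::
    "('a, 'v) schema \<Rightarrow> ('a, 'v) gb_query \<Rightarrow> ('a, 'v) tup multiset \<Rightarrow> real" where
  "agg S Q E =
     (let total = (\<Sum>t\<in>#E. num S (t (agg_attr Q)))
      in case agg_fun Q of
           Count \<Rightarrow> real (size E)
         | Sum \<Rightarrow> total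
         | Avg \<Rightarrow> total / real (size E))"

definition weight ::
    "('a, 'v) gb_query \<Rightarrow> 'v \<Rightarrow> 'v \<Rightarrow> (('a, 'v) tup \<Rightarrow> bool) \<Rightarrow> ('a, 'v) tup multiset \<Rightarrow> real" where
  "weight Q \<alpha>i \<alpha>j p D =
     (let m = real (min (size (group Q \<alpha>i (neg_sel p D))) (size (group Q \<alpha>j (neg_sel p D))));
          M = real (max (size (group Q \<alpha>i D)) (size (group Q \<alpha>j D)))
      in case agg_fun Q of Count \<Rightarrow> m / (M + 1) | Sum \<Rightarrow> m / (M + 1) | Avg \<Rightarrow> m)"

definition influence ::
    "('a, 'v) schema \<Rightarrow> ('a, 'v) gb_query \<Rightarrow> 'v \<Rightarrow> 'v \<Rightarrow> (('a, 'v) tup \<Rightarrow> bool)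
       \<Rightarrow> ('a, 'v) tup multiset \<Rightarrow> real" where
  "influence S Q \<alpha>i \<alpha>j p D =
     ((agg S Q (group Q \<alpha>i D) - agg S Q (group Q \<alpha>j D))
      - (agg S Q (group Q \<alpha>i (neg_sel p D)) - agg S Q (group Q \<alpha>j (neg_sel p D))))
     * weight Q \<alpha>i \<alpha>j p D"

text \<open>The supremum is taken in \<open>[0, \<infinity>]\<close>, so it is meaningful without a boundedness proof.\<close>

definition sensitivity ::
    "('a, 'v) schema \<Rightarrow> (('a, 'v) tup multiset \<Rightarrow> real) \<Rightarrow> ennreal" where
  "sensitivity S f = (SUP (D, D') \<in> {(D, D'). neighboring S D D'}. ennreal \<bar>f D - f D'\<bar>)"

text \<open>``Has sensitivity \<open>c\<close>'' is the usual phrase of differential privacy for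
  \<open>sensitivity S f \<le> c\<close>, the bound to which noise is calibrated. The influence
  does not satisfy it with equality for every query and predicate, as the following shows.\<close>

lemma sensitivity_influence_unsatisfiable:
  assumes "where_cond Q = (\<lambda>_. False)"
  shows "sensitivity S (influence S Q \<alpha>i \<alpha>j p) = 0"
proof -
  have "influence S Q \<alpha>i \<alpha>j p D = 0" for D
    using assms by (simp add: influence_def weight_def group_def)
  then show ?thesis
    by (auto simp: sensitivity_def bot_ennreal intro: SUP_eq_const antisym SUP_least)
qed

end

theory Submission imports Defs begin

text \<open>Adding a tuple changes the influence, a difference \<open>z\<close> of aggregates times a weight \<open>w\<close>,
  by \<open>\<bar>z' w' - z w\<bar> \<le> \<bar>z' - z\<bar> w + \<bar>z'\<bar> \<bar>w' - w\<bar>\<close>. Let the aggregated values be bounded by \<open>A\<close>, and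
  let \<open>M'\<close> be the size of the larger group after the addition. For sums (counts are sums of ones)
  only the tuples satisfying \<open>p\<close> contribute to \<open>z\<close>: it changes by at most \<open>2 A\<close> and
  \<open>\<bar>z'\<bar> \<le> 2 A M'\<close>, while \<open>w \<le> 1\<close> changes by at most \<open>1 / (M' + 1)\<close>; this gives \<open>4 A\<close>. For
  averages, each of the four aggregates changes by at most \<open>2 A\<close> divided by its group size, hence by
  at most \<open>2 A / w\<close>, and \<open>w\<close> changes by at most \<open>1\<close>; this gives \<open>4 \<cdot> 2 A + 4 A = 12 A\<close>.\<close>

text \<open>Both \<open>neighboring\<close> and the absolute difference are symmetric in the two
  databases, so removing a tuple is covered by adding one.\<close>

lemma sensitivity_le:
  assumes "\<And>D t. database S (add_mset t D) \<Longrightarrow> \<bar>f (add_mset t D) - f D\<bar> \<le> c"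
  shows "sensitivity S f \<le> ennreal c"
proof -
  have "\<bar>f D - f D'\<bar> \<le> c" if "neighboring S D D'" for D D'
    using that assms unfolding neighboring_def by (metis abs_minus_commute)
  then show ?thesis
    unfolding sensitivity_def by (intro SUP_least) (auto intro: ennreal_leI)
qed

text \<open>Insert the mixed term \<open>z' * w\<close>. The change of \<open>z\<close> is thus
  paired with the old weight, which for averages is at most the old size of each bag, the scaling in
  \<open>average_add_mset_diff\<close>.\<close>

lemma abs_weighted_diff_le:
  fixes z z' w w' :: real
  assumes "0 \<le> w"
  shows "\<bar>z' * w' - z * w\<bar> \<le> \<bar>z' - z\<bar> * w + \<bar>z'\<bar> * \<bar>w' - w\<bar>"
proof -
  have "z' * w' - z * w = (z' - z) * w + z' * (w' - w)"
    by (simp add: algebra_simps)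
  then show ?thesis
    using assms by (metis abs_mult abs_of_nonneg abs_triangle_ineq)
qed

lemma abs_sum_mset_le:
  fixes h :: "'b \<Rightarrow> real"
  assumes "\<And>t. t \<in># E \<Longrightarrow> \<bar>h t\<bar> \<le> A"
  shows "\<bar>\<Sum>t\<in>#E. h t\<bar> \<le> A * real (size E)"
  using assms
proof (induction E)
  case (add t E)
  have "\<bar>h t\<bar> \<le> A" and "\<bar>\<Sum>t\<in>#E. h t\<bar> \<le> A * real (size E)"
    using add by auto
  then show ?case by (simp add: algebra_simps)
qed simp

definition average :: "('b \<Rightarrow> real) \<Rightarrow> 'b multiset \<Rightarrow> real" where
  "average h E = (\<Sum>t\<in>#E. h t) / real (size E)"

text \<open>Divide \<open>abs_sum_mset_le\<close> by the size; \<open>0 \<le> A\<close> serves the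
  empty bag, whose average is 0.\<close>

lemma abs_average_le:
  assumes "\<And>t. t \<in># E \<Longrightarrow> \<bar>h t\<bar> \<le> A" and "0 \<le> A"
  shows "\<bar>average h E\<bar> \<le> A"
proof (cases "E = {#}")
  case False
  then have "0 < real (size E)" by (simp add: nonempty_has_size)
  then show ?thesis
    using abs_sum_mset_le[of E h A] assms(1) by (simp add: average_def divide_le_eq)
qed (simp add: average_def assms(2))

text \<open>With n the size and a the average of \<open>E\<close>, the new average is (n a + h t) /
  (n + 1), which exceeds a by (h t - a) / (n + 1). For empty \<open>E\<close> both sides
  vanish.\<close>

lemma average_add_mset_diff:
  "(average h (add_mset t E) - average h E) * real (size E)
     = (h t - average h E) * (real (size E) / (real (size E) + 1))"
proof (cases "E = {#}")
  case False
  then have "0 < real (size E)" by (simp add: nonempty_has_size)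
  then show ?thesis
    by (simp add: average_def field_simps)
qed (simp add: average_def)

text \<open>If \<open>t\<close> passes the filter, \<open>average_add_mset_diff\<close> applies: n /
  (n + 1) is at most 1, and \<open>h t\<close> and the old average both lie in [-A, A]. Otherwise
  nothing changes. The number \<open>m\<close> will be the weight.\<close>

lemma average_filter_add_mset_diff_le:
  assumes h: "\<And>s. s \<in># add_mset t E \<Longrightarrow> \<bar>h s\<bar> \<le> A" and A: "0 \<le> A"
    and m: "0 \<le> m" "m \<le> real (size (filter_mset P E))"
  shows "\<bar>average h (filter_mset P (add_mset t E)) - average h (filter_mset P E)\<bar> * m \<le> 2 * A"
proof (cases "P t")
  case True
  let ?F = "filter_mset P E"
  have "\<bar>average h (add_mset t ?F) - average h ?F\<bar> * m
      \<le> \<bar>average h (add_mset t ?F) - average h ?F\<bar> * real (size ?F)"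
    using m by (intro mult_left_mono) auto
  also have "\<dots> = \<bar>h t - average h ?F\<bar> * (real (size ?F) / (real (size ?F) + 1))"
    using arg_cong[OF average_add_mset_diff[of h t ?F], of abs] by (simp add: abs_mult)
  also have "\<dots> \<le> \<bar>h t - average h ?F\<bar> * 1"
    by (intro mult_left_mono) (auto simp: divide_le_eq)
  also have "\<dots> \<le> 2 * A"
    using h[of t] abs_average_le[of ?F h A] h A by force
  finally show ?thesis using True by simp
qed (use A in simp)

text \<open>Put both fractions over M' + 1. With r = m / (M + 1) in [0, 1], the numerator m' - r (M'
  + 1) is one of 0, 1, -r and 1 - r.\<close>

lemma weight_add_mset_diff_le:
  fixes m m' M M' :: nat
  assumes "m \<le> m'" "m' \<le> Suc m" "M \<le> M'" "M' \<le> Suc M" "m \<le> M"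
  shows "\<bar>real m' / (real M' + 1) - real m / (real M + 1)\<bar> \<le> 1 / (real M' + 1)"
proof -
  define r where "r = real m / (real M + 1)"
  have r: "0 \<le> r" "r \<le> 1" "r * (real M + 1) = real m"
    using assms(5) by (auto simp: r_def divide_le_eq)
  have "real m' / (real M' + 1) - r = (real m' - r * (real M' + 1)) / (real M' + 1)"
    by (simp add: diff_divide_distrib add_eq_0_iff)
  moreover have "\<bar>real m' - r * (real M' + 1)\<bar> \<le> 1"
  proof -
    have "m' = m \<or> m' = Suc m" "M' = M \<or> M' = Suc M" using assms by auto
    then show ?thesis
      using r by (auto simp: distrib_left)
  qed
  ultimately show ?thesis
    by (simp add: r_def[symmetric] divide_right_mono)
qed

text \<open>Merges the nested filters into one, the form that
  \<open>average_filter_add_mset_diff_le\<close> expects.\<close>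

lemma group_neg_sel:
  "group Q \<alpha> (neg_sel p D)
     = filter_mset (\<lambda>t. \<not> p t \<and> where_cond Q t \<and> t (gb_attr Q) = \<alpha>) D"
  by (auto simp: group_def neg_sel_def filter_filter_mset conj_ac)

lemma size_group_neg_sel_le: "size (group Q \<alpha> (neg_sel p D)) \<le> size (group Q \<alpha> D)"
  unfolding group_def neg_sel_def by (intro size_mset_mono multiset_filter_mono) simp

text \<open>Supplies the hypotheses of \<open>weight_add_mset_diff_le\<close>: one tuple enlarges
  each of the bags by at most one.\<close>

lemma min_max_size_group_add_mset:
  fixes Q :: "('a, 'v) gb_query"
  defines "m \<equiv> \<lambda>\<alpha> \<beta> p D. min (size (group Q \<alpha> (neg_sel p D))) (size (group Q \<beta> (neg_sel p D)))"
    and "M \<equiv> \<lambda>\<alpha> \<beta> D. max (size (group Q \<alpha> D)) (size (group Q \<beta> D))"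
  shows "m \<alpha> \<beta> p D \<le> m \<alpha> \<beta> p (add_mset t D)" "m \<alpha> \<beta> p (add_mset t D) \<le> Suc (m \<alpha> \<beta> p D)"
    "M \<alpha> \<beta> D \<le> M \<alpha> \<beta> (add_mset t D)" "M \<alpha> \<beta> (add_mset t D) \<le> Suc (M \<alpha> \<beta> D)"
    "m \<alpha> \<beta> p D \<le> M \<alpha> \<beta> D"
proof -
  show "m \<alpha> \<beta> p D \<le> M \<alpha> \<beta> D"
    using size_group_neg_sel_le[of Q \<alpha> p D] by (auto simp: m_def M_def)
qed (auto simp: m_def M_def group_def neg_sel_def)

text \<open>The summand \<open>h\<close> is left general so that Count and Sum share one
  proof.\<close>

lemma sum_influence_add_mset_diff_le:
  fixes Q :: "('a, 'v) gb_query" and h :: "('a, 'v) tup \<Rightarrow> real"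
    and \<alpha> \<beta> :: 'v and p :: "('a, 'v) tup \<Rightarrow> bool"
  defines "z \<equiv> \<lambda>D. ((\<Sum>t\<in>#group Q \<alpha> D. h t) - (\<Sum>t\<in>#group Q \<beta> D. h t))
      - ((\<Sum>t\<in>#group Q \<alpha> (neg_sel p D). h t) - (\<Sum>t\<in>#group Q \<beta> (neg_sel p D). h t))"
    and "w \<equiv> \<lambda>D.
        real (min (size (group Q \<alpha> (neg_sel p D))) (size (group Q \<beta> (neg_sel p D))))
        / (real (max (size (group Q \<alpha> D)) (size (group Q \<beta> D))) + 1)"
  assumes h: "\<And>s. s \<in># add_mset t D \<Longrightarrow> \<bar>h s\<bar> \<le> A" and A: "0 \<le> A"
  shows "\<bar>z (add_mset t D) * w (add_mset t D) - z D * w D\<bar> \<le> 4 * A"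
proof -
  let ?D = "add_mset t D"
  define s where "s = (\<lambda>\<gamma> D. \<Sum>t\<in>#group Q \<gamma> (filter_mset p D). h t)"
  define m where "m = (\<lambda>D. min (size (group Q \<alpha> (neg_sel p D))) (size (group Q \<beta> (neg_sel p D))))"
  define M where "M = (\<lambda>D. max (size (group Q \<alpha> D)) (size (group Q \<beta> D)))"
  \<comment> \<open>The tuples violating \<open>p\<close> cancel, leaving the sum over those
    satisfying it.\<close>
  have sd: "(\<Sum>t\<in>#group Q \<gamma> E. h t) - (\<Sum>t\<in>#group Q \<gamma> (neg_sel p E). h t) = s \<gamma> E" for \<gamma> E
    by (induction E) (auto simp: s_def group_def neg_sel_def)
  have z: "z E = s \<alpha> E - s \<beta> E" for E
    using sd[of \<alpha> E] sd[of \<beta> E] unfolding z_def by linarith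
  have w: "w E = real (m E) / (real (M E) + 1)" for E
    by (simp add: w_def m_def M_def)
  have "\<bar>s \<gamma> ?D - s \<gamma> D\<bar> \<le> A" for \<gamma>
    using h[of t] A by (auto simp: s_def group_def)
  from this[of \<alpha>] this[of \<beta>] have dz: "\<bar>z ?D - z D\<bar> \<le> 2 * A"
    unfolding z by linarith
  have s: "\<bar>s \<gamma> ?D\<bar> \<le> A * real (size (group Q \<gamma> ?D))" for \<gamma>
  proof -
    have "\<bar>s \<gamma> ?D\<bar> \<le> A * real (size (group Q \<gamma> (filter_mset p ?D)))"
      unfolding s_def by (rule abs_sum_mset_le) (use h in \<open>auto simp: group_def split: if_splits\<close>)
    also have "size (group Q \<gamma> (filter_mset p ?D)) \<le> size (group Q \<gamma> ?D)"
      unfolding group_def by (intro size_mset_mono multiset_filter_mono multiset_filter_subset)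
    then have "A * real (size (group Q \<gamma> (filter_mset p ?D))) \<le> A * real (size (group Q \<gamma> ?D))"
      using A by (intro mult_left_mono) auto
    finally show ?thesis .
  qed
  have "A * real (size (group Q \<gamma> ?D)) \<le> A * real (M ?D)" if "\<gamma> \<in> {\<alpha>, \<beta>}" for \<gamma>
    using A that by (intro mult_left_mono) (auto simp: M_def)
  from this[of \<alpha>] this[of \<beta>] s[of \<alpha>] s[of \<beta>] have z': "\<bar>z ?D\<bar> \<le> 2 * A * real (M ?D)"
    unfolding z by simp
  have mM: "m D \<le> m ?D" "m ?D \<le> Suc (m D)" "M D \<le> M ?D" "M ?D \<le> Suc (M D)" "m D \<le> M D"
    unfolding m_def M_def by (rule min_max_size_group_add_mset)+
  have dw: "\<bar>w ?D - w D\<bar> \<le> 1 / (real (M ?D) + 1)"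
    unfolding w by (intro weight_add_mset_diff_le mM)
  have w01: "0 \<le> w D" "w D \<le> 1"
    using mM(5) by (auto simp: w divide_le_eq)
  have "\<bar>z ?D * w ?D - z D * w D\<bar> \<le> \<bar>z ?D - z D\<bar> * w D + \<bar>z ?D\<bar> * \<bar>w ?D - w D\<bar>"
    by (rule abs_weighted_diff_le) (rule w01)
  also have "\<dots> \<le> (2 * A) * 1 + (2 * A * real (M ?D)) * (1 / (real (M ?D) + 1))"
    using dz z' dw w01 A by (intro add_mono mult_mono) auto
  also have "\<dots> = 2 * A * 1 + 2 * A * (real (M ?D) / (real (M ?D) + 1))"
    by simp
  \<comment> \<open>The growth of \<open>z\<close> with the larger group is absorbed by the
    denominator of the weight: M' / (M' + 1) is at most 1.\<close>
  also have "\<dots> \<le> 2 * A * 1 + 2 * A * 1"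
    using A by (intro add_mono mult_left_mono) (auto simp: divide_le_eq)
  finally show ?thesis by simp
qed

text \<open>Averages over \<open>D\<close> and over \<open>neg_sel p D\<close> have different
  denominators, so the cancellation used for sums is lost and the four averages are bounded one by
  one.\<close>

lemma average_influence_add_mset_diff_le:
  fixes Q :: "('a, 'v) gb_query" and h :: "('a, 'v) tup \<Rightarrow> real"
    and \<alpha> \<beta> :: 'v and p :: "('a, 'v) tup \<Rightarrow> bool"
  defines "z \<equiv> \<lambda>D. (average h (group Q \<alpha> D) - average h (group Q \<beta> D))
      - (average h (group Q \<alpha> (neg_sel p D)) - average h (group Q \<beta> (neg_sel p D)))"
    and "w \<equiv> \<lambda>D.
        real (min (size (group Q \<alpha> (neg_sel p D))) (size (group Q \<beta> (neg_sel p D))))"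
  assumes h: "\<And>s. s \<in># add_mset t D \<Longrightarrow> \<bar>h s\<bar> \<le> A" and A: "0 \<le> A"
  shows "\<bar>z (add_mset t D) * w (add_mset t D) - z D * w D\<bar> \<le> 12 * A"
proof -
  let ?D = "add_mset t D"
  \<comment> \<open>The weight is at most the size of the group after removing the tuples satisfying
    \<open>p\<close>, hence at most the size of the full group.\<close>
  have g: "\<bar>average h (group Q \<gamma> ?D) - average h (group Q \<gamma> D)\<bar> * w D \<le> 2 * A"
    if "\<gamma> \<in> {\<alpha>, \<beta>}" for \<gamma>
    unfolding group_def
    by (rule average_filter_add_mset_diff_le[OF h A])
      (use size_group_neg_sel_le[of Q \<gamma> p D] that in \<open>auto simp: w_def simp flip: group_def\<close>)
  have n: "\<bar>average h (group Q \<gamma> (neg_sel p ?D)) - average h (group Q \<gamma> (neg_sel p D))\<bar> * w D \<le> 2 * A"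
    if "\<gamma> \<in> {\<alpha>, \<beta>}" for \<gamma>
    unfolding group_neg_sel
    by (rule average_filter_add_mset_diff_le[OF h A])
      (use that in \<open>auto simp: w_def simp flip: group_neg_sel\<close>)
  have w0: "0 \<le> w D"
    by (simp add: w_def)
  have dw: "\<bar>w ?D - w D\<bar> \<le> 1"
    using min_max_size_group_add_mset(1,2)[where Q = Q and \<alpha> = \<alpha> and \<beta> = \<beta> and p = p and D = D and t = t] unfolding w_def by linarith
  have "\<bar>z ?D - z D\<bar> * w D
      \<le> (\<bar>average h (group Q \<alpha> ?D) - average h (group Q \<alpha> D)\<bar>
        + \<bar>average h (group Q \<beta> ?D) - average h (group Q \<beta> D)\<bar>
        + \<bar>average h (group Q \<alpha> (neg_sel p ?D)) - average h (group Q \<alpha> (neg_sel p D))\<bar>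
        + \<bar>average h (group Q \<beta> (neg_sel p ?D)) - average h (group Q \<beta> (neg_sel p D))\<bar>) * w D"
    using w0 unfolding z_def by (intro mult_right_mono) linarith+
  also have "\<dots> \<le> 8 * A"
    using g[of \<alpha>] g[of \<beta>] n[of \<alpha>] n[of \<beta>] by (simp add: distrib_right)
  finally have dz: "\<bar>z ?D - z D\<bar> * w D \<le> 8 * A" .
  have "\<bar>average h (group Q \<gamma> E)\<bar> \<le> A" if "set_mset E \<subseteq> set_mset ?D" for \<gamma> E
    by (rule abs_average_le[OF h A]) (use that in \<open>auto simp: group_def\<close>)
  from this[of ?D \<alpha>] this[of ?D \<beta>] this[of "neg_sel p ?D" \<alpha>] this[of "neg_sel p ?D" \<beta>]
  have z': "\<bar>z ?D\<bar> \<le> 4 * A"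
    unfolding z_def by (auto simp: neg_sel_def subset_iff)
  have "\<bar>z ?D * w ?D - z D * w D\<bar> \<le> \<bar>z ?D - z D\<bar> * w D + \<bar>z ?D\<bar> * \<bar>w ?D - w D\<bar>"
    by (rule abs_weighted_diff_le) (rule w0)
  \<comment> \<open>Four averages give 2 A each; the bound 4 A on the new \<open>z\<close> meets a
    weight change of at most 1.\<close>
  also have "\<dots> \<le> 8 * A + (4 * A) * 1"
    by (intro add_mono dz mult_mono z' dw) (use A in auto)
  finally show ?thesis by simp
qed

theorem proposition4p4:
  fixes S :: "('a, 'v) schema" and Q :: "('a, 'v) gb_query"
    and p :: "('a, 'v) tup \<Rightarrow> bool" and \<alpha>i \<alpha>j :: 'v and A_max :: real
  assumes "finite (attrs S)"
    and "query_over S Q"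
    and "\<alpha>i \<in> attr_dom S (gb_attr Q)" and "\<alpha>j \<in> attr_dom S (gb_attr Q)"
    and "explanation_predicate S Q p"
  shows "(agg_fun Q = Count \<longrightarrow> sensitivity S (influence S Q \<alpha>i \<alpha>j p) \<le> 4)
       \<and> (agg_fun Q = Sum \<longrightarrow> is_agg_max S Q A_max \<longrightarrow>
            sensitivity S (influence S Q \<alpha>i \<alpha>j p) \<le> ennreal (4 * A_max))
       \<and> (agg_fun Q = Avg \<longrightarrow> is_agg_max S Q A_max \<longrightarrow>
            sensitivity S (influence S Q \<alpha>i \<alpha>j p) \<le> ennreal (16 * A_max))"
proof (intro conjI impI)
  \<comment> \<open>The maximum is attained, so it is an absolute value and nonnegative;
    \<open>query_over\<close> ensures that the aggregated values lie in the attribute's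
    domain.\<close>
  have agg_attr_bound: "0 \<le> A_max"
    "\<And>D s. database S D \<Longrightarrow> s \<in># D \<Longrightarrow> \<bar>num S (s (agg_attr Q))\<bar> \<le> A_max"
    if "is_agg_max S Q A_max"
    using that assms(2)
    by (auto simp: is_agg_max_def query_over_def database_def tuples_def subset_iff)
  show "sensitivity S (influence S Q \<alpha>i \<alpha>j p) \<le> 4" if Q: "agg_fun Q = Count"
  proof -
    have "sensitivity S (influence S Q \<alpha>i \<alpha>j p) \<le> ennreal 4"
    proof (rule sensitivity_le)
      fix D t
      show "\<bar>influence S Q \<alpha>i \<alpha>j p (add_mset t D) - influence S Q \<alpha>i \<alpha>j p D\<bar> \<le> 4"
        \<comment> \<open>A count is the sum of the constant 1, so A = 1.\<close>
        using sum_influence_add_mset_diff_le[of t D "\<lambda>_. 1" 1 Q \<alpha>i \<alpha>j p]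
        by (simp add: influence_def agg_def weight_def Q Let_def)
    qed
    then show ?thesis by simp
  qed
  show "sensitivity S (influence S Q \<alpha>i \<alpha>j p) \<le> ennreal (4 * A_max)"
    if Q: "agg_fun Q = Sum" and A: "is_agg_max S Q A_max"
  proof (rule sensitivity_le)
    fix D t
    assume "database S (add_mset t D)"
    with agg_attr_bound[OF A]
    show "\<bar>influence S Q \<alpha>i \<alpha>j p (add_mset t D) - influence S Q \<alpha>i \<alpha>j p D\<bar> \<le> 4 * A_max"
      unfolding influence_def agg_def weight_def Let_def Q aggregate.case
      by (intro sum_influence_add_mset_diff_le) auto
  qed
  show "sensitivity S (influence S Q \<alpha>i \<alpha>j p) \<le> ennreal (16 * A_max)"
    if Q: "agg_fun Q = Avg" and A: "is_agg_max S Q A_max"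
  proof (rule sensitivity_le)
    fix D t
    assume "database S (add_mset t D)"
    with agg_attr_bound[OF A]
    have "\<bar>influence S Q \<alpha>i \<alpha>j p (add_mset t D) - influence S Q \<alpha>i \<alpha>j p D\<bar> \<le> 12 * A_max"
      unfolding influence_def agg_def weight_def Let_def Q aggregate.case average_def[symmetric]
      by (intro average_influence_add_mset_diff_le) auto
    \<comment> \<open>Since \<open>A_max\<close> is nonnegative, 12 \<open>A_max\<close> is at most
      16 \<open>A_max\<close>.\<close>
    then show "\<bar>influence S Q \<alpha>i \<alpha>j p (add_mset t D) - influence S Q \<alpha>i \<alpha>j p D\<bar> \<le> 16 * A_max"
      using agg_attr_bound(1)[OF A] by linarith
  qed
qed

end
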